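(* Let $f\in\mathbb{Z}[x]$ and let $B\subset\mathbb{N}$ be of the form $B=f(\mathbb{Z})\cap\mathbb{N}$ or $B=f(\mathbb{N})\cap\mathbb{N}$, and assume $B$ is infinite. Then $B=\Pr(A)$ for some $A\subset\mathbb{N}$ if and only if $B=\mathbb{N}$ or $B=\{2n-1:n\in\mathbb{N}\}$.
   Context: $\mathbb{N}=\{1,2,3,\dots\}$. For $m\in\mathbb{N}$, $D(m)$ is the set of positive divisors of $m$. For $A\subset\mathbb{N}$, $S_A=\sum_{a\in A}a$ ($S_\emptyset=0$, $S_A=+\infty$ for infinite $A$), and $A$ is a practical set if every non-negative integer $k\le S_A$ is a sum of distinct elements of $A$. A number $m\in\mathbb{N}$ is $A$-practical if $D(m)\cap A$ is a practical set, and $\Pr(A)$ is the set of all $A$-practical numbers. *)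

theory Defs
  imports "HOL-Computational_Algebra.Polynomial" "HOL-Library.Extended_Nat"
begin

text \<open>The positive integers \<open>{1, 2, 3, \<dots>}\<close>, as opposed to the type \<^typ>\<open>nat\<close>, which contains 0.\<close>
definition posnat :: "nat set" where
  "posnat = {1..}"

definition pos_divisors :: "nat \<Rightarrow> nat set" where
  "pos_divisors m = {d \<in> posnat. d dvd m}"

text \<open>The library sum over an infinite set is 0, hence the explicit case distinction.\<close>
definition set_sum :: "nat set \<Rightarrow> enat" where
  "set_sum A = (if finite A then enat (\<Sum>a\<in>A. a) else \<infinity>)"

text \<open>The empty set counts as practical: its only target 0 is the empty sum.\<close>
definition practical_set :: "nat set \<Rightarrow> bool" where
  "practical_set A \<longleftrightarrow>
     (\<forall>k::nat. enat k \<le> set_sum A \<longrightarrow> (\<exists>F. finite F \<and> F \<subseteq> A \<and> k = (\<Sum>a\<in>F. a)))"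

definition Pr :: "nat set \<Rightarrow> nat set" where
  "Pr A = {m \<in> posnat. practical_set (pos_divisors m \<inter> A)}"

end

theory Submission
  imports Defs "HOL-Computational_Algebra.Primes"
begin

text \<open>
  A practical set of odd numbers cannot represent 2 unless it is contained in \<open>{1}\<close>; hence the
  divisors of an odd \<open>A\<close>-practical number are \<open>A\<close>-practical. Moreover 1 is always \<open>A\<close>-practical.
  If \<open>B\<close> consists of values of \<open>f\<close>, then \<open>f\<close> takes the value 1, so it takes large odd values in \<open>B\<close>,
  and an odd prime factor \<open>p = f(m)\<close> of one of them lies in \<open>B\<close>. Now \<open>f(m + 2pk)\<close> is odd and
  divisible by \<open>p\<close>, so the quotient is again a value: \<open>f(m + 2pk) = p f(y\<^sub>k)\<close> for large \<open>k\<close>. With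
  \<open>d = deg f\<close> and \<open>a\<close> the modulus of the leading coefficient, the \<open>d\<close>-th root of \<open>f(x)/a\<close> is
  \<open>|x| + const + o(1)\<close>, the constant depending on the sign of \<open>x\<close>. Two of any three consecutive
  \<open>y\<^sub>k\<close> have the same sign, so \<open>4p\<close> divided by the \<open>d\<close>-th root of \<open>p\<close> is a limit of integers, hence an
  integer, and comparing \<open>p\<close>-adic valuations gives \<open>d = 1\<close>. Then \<open>B\<close> is the progression
  1 mod \<open>a\<close>; it contains the odd number \<open>(2a - 1)\<^sup>2\<close>, hence \<open>2a - 1\<close>, which forces \<open>a\<close> to divide 2.
\<close>

section \<open>Practical sets and odd \<open>A\<close>-practical numbers\<close>

lemma practical_subset_1:
  assumes "X \<subseteq> {1}"
  shows "practical_set X"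
proof -
  consider "X = {}" | "X = {1}" using assms by blast
  then show ?thesis
  proof cases
    case 1
    then show ?thesis by (auto simp: practical_set_def set_sum_def)
  next
    case 2
    have "\<exists>F. finite F \<and> F \<subseteq> {1} \<and> k = \<Sum>F" if "k \<le> 1" for k :: nat
    proof (cases "k = 0")
      case True
      then show ?thesis by (intro exI[of _ "{}"]) auto
    next
      case False
      with that show ?thesis by (intro exI[of _ "{1}"]) auto
    qed
    with 2 show ?thesis by (auto simp: practical_set_def set_sum_def)
  qed
qed

text \<open>An element other than 1 is at least 3, so the target 2 would be within reach of the
  total sum. Odd summands of 2 can only be 1, and 1 may be taken only once.\<close>

lemma practical_odd_subset_1:
  assumes "practical_set X" "finite X" "\<And>x. x \<in> X \<Longrightarrow> odd x"
  shows "X \<subseteq> {1}"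
proof
  fix x assume x: "x \<in> X"
  show "x \<in> {1}"
  proof (rule ccontr)
    assume "x \<notin> {1}"
    with assms(3)[OF x] have "x \<ge> 2" by (cases "x = 0") auto
    also have "x \<le> \<Sum>X" using x assms(2) by (intro member_le_sum[where f = "\<lambda>x. x"]) auto
    finally have "enat 2 \<le> set_sum X" using assms(2) by (simp add: set_sum_def)
    then obtain F where F: "finite F" "F \<subseteq> X" "2 = \<Sum>F"
      using assms(1) unfolding practical_set_def by blast
    have "F \<subseteq> {1}"
    proof
      fix y assume y: "y \<in> F"
      then have "y \<le> \<Sum>F" using F(1) by (intro member_le_sum[where f = "\<lambda>x. x"]) simp_all
      then have "y = 0 \<or> y = 1 \<or> y = 2" unfolding F(3)[symmetric] by linarith
      moreover have "odd y" using y F(2) assms(3) by blast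
      ultimately show "y \<in> {1}" by auto
    qed
    then have "\<Sum>F \<le> \<Sum>{1::nat}" by (intro sum_mono2) simp_all
    with F(3) show False by simp
  qed
qed

lemma finite_pos_divisors: "m \<in> posnat \<Longrightarrow> finite (pos_divisors m)"
  by (auto simp: pos_divisors_def posnat_def intro: finite_subset[of _ "{..m}"] dest!: dvd_imp_le)

lemma one_in_Pr: "1 \<in> Pr A"
proof -
  have "pos_divisors 1 \<inter> A \<subseteq> {1}" by (auto simp: pos_divisors_def)
  then show ?thesis using practical_subset_1 by (auto simp: Pr_def posnat_def)
qed

text \<open>All divisors of an odd number are odd, so the part of \<open>A\<close> among them lies
  in \<open>{1}\<close>; passing to the divisors of \<open>d\<close> only shrinks it.\<close>

lemma odd_in_Pr_dvd:
  assumes "b \<in> Pr A" "odd b" "d dvd b"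
  shows "d \<in> Pr A"
proof -
  have b: "b \<in> posnat" "practical_set (pos_divisors b \<inter> A)" using assms by (auto simp: Pr_def)
  have "pos_divisors b \<inter> A \<subseteq> {1}"
    using b finite_pos_divisors assms(2)
    by (intro practical_odd_subset_1) (auto simp: pos_divisors_def)
  moreover have "pos_divisors d \<subseteq> pos_divisors b"
    using assms(3) by (auto simp: pos_divisors_def)
  ultimately have "pos_divisors d \<inter> A \<subseteq> {1}" by blast
  moreover have "d \<in> posnat" using assms(2,3) by (cases "d = 0") (auto simp: posnat_def)
  ultimately show ?thesis using practical_subset_1 by (auto simp: Pr_def)
qed

lemma Pr_empty: "Pr {} = posnat"
  using practical_subset_1[of "{}"] by (auto simp: Pr_def)

text \<open>On \<open>nat\<close> the term \<open>2 * n - 1\<close> is truncated to 0 at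
  \<open>n = 0\<close>; membership in \<open>posnat\<close> keeps this even value out.\<close>

lemma odd_numbers_eq: "{2 * n - 1 | n. n \<in> posnat} = {m. odd m}"
proof (intro set_eqI iffI)
  fix m :: nat assume "m \<in> {m. odd m}"
  then obtain k where "m = 2 * k + 1" by (auto elim: oddE)
  then have "m = 2 * (k + 1) - 1" "k + 1 \<in> posnat" by (simp_all add: posnat_def)
  then show "m \<in> {2 * n - 1 | n. n \<in> posnat}" by blast
qed (auto simp: posnat_def)

text \<open>An even \<open>m\<close> sees the set \<open>{2}\<close>, which misses the target 1,
  while an odd \<open>m\<close> sees the empty set, which is practical.\<close>

lemma Pr_2: "Pr {2} = {2 * n - 1 | n. n \<in> posnat}"
proof -
  have "m \<in> Pr {2} \<longleftrightarrow> odd m" for m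
  proof
    assume "m \<in> Pr {2}"
    show "odd m"
    proof
      assume "even m"
      then have "pos_divisors m \<inter> {2} = {2}" by (auto simp: pos_divisors_def posnat_def)
      with \<open>m \<in> Pr {2}\<close> have "practical_set {2}" by (simp add: Pr_def)
      moreover have "enat 1 \<le> set_sum {2}" by (simp add: set_sum_def)
      ultimately obtain F where "F \<subseteq> {2}" "(1::nat) = \<Sum>F"
        unfolding practical_set_def by blast
      then show False by (auto simp: subset_singleton_iff)
    qed
  next
    assume "odd m"
    then have "pos_divisors m \<inter> {2} = {}" "m \<in> posnat"
      by (auto simp: pos_divisors_def posnat_def intro: Suc_leI odd_pos)
    with practical_subset_1[of "{}"] show "m \<in> Pr {2}" by (simp add: Pr_def)
  qed
  then show ?thesis unfolding odd_numbers_eq by blast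
qed

section \<open>Integer polynomials: congruences and growth\<close>

lemma poly_diff_dvd: "x - y dvd poly f x - poly f y" for f :: "'a::comm_ring_1 poly"
proof (induction f)
  case (pCons a p)
  have "poly (pCons a p) x - poly (pCons a p) y = x * (poly p x - poly p y) + (x - y) * poly p y"
    by (simp add: algebra_simps)
  with pCons show ?case by (metis dvd_add dvd_mult dvd_triv_left)
qed simp

abbreviation real_poly :: "int poly \<Rightarrow> real poly" where
  "real_poly \<equiv> map_poly real_of_int"

lemma poly_real_poly: "poly (real_poly f) (of_int x) = of_int (poly f x)"
  by (induction f) (auto simp: map_poly_pCons)

lemma degree_real_poly: "degree (real_poly f) = degree f"
  by (simp add: degree_map_poly)

lemma coeff_real_poly: "coeff (real_poly f) n = of_int (coeff f n)"
  by (simp add: coeff_map_poly)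

text \<open>Since the degree is positive, subtracting \<open>K\<close> leaves the leading
  coefficient unchanged, and a polynomial with positive leading coefficient eventually stays above
  that coefficient.\<close>

lemma int_poly_gt:
  fixes f :: "int poly"
  assumes "lead_coeff f > 0" "degree f > 0"
  shows "\<exists>N. \<forall>n\<ge>N. poly f n > K"
proof -
  let ?g = "real_poly (f - [:K:])"
  have deg: "degree (f - [:K:]) = degree f"
    unfolding diff_conv_add_uminus using assms(2) by (intro degree_add_eq_left) simp
  have "lead_coeff (f - [:K:]) = lead_coeff f"
    unfolding deg using assms(2) by (cases "degree f") auto
  then have lc: "lead_coeff ?g > 0"
    using assms(1) by (simp add: degree_real_poly coeff_real_poly)
  from poly_pinfty_gt_lc[OF this] obtain X where X: "\<And>x. x \<ge> X \<Longrightarrow> poly ?g x \<ge> lead_coeff ?g"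
    by blast
  have "poly f n > K" if "n \<ge> \<lceil>X\<rceil>" for n
  proof -
    have "poly ?g (of_int n) > 0" using X[of "of_int n"] lc that by linarith
    then show ?thesis unfolding poly_real_poly by simp
  qed
  then show ?thesis by blast
qed

section \<open>Asymptotics of the \<open>d\<close>-th root of a polynomial\<close>

lemma poly_divide_power_tendsto:
  fixes p :: "real poly"
  assumes "degree p \<le> n"
  shows "((\<lambda>x. poly p x / x ^ n) \<longlongrightarrow> coeff p n) at_infinity"
proof (cases "degree p = n")
  case True
  then show ?thesis using poly_divide_tendsto_aux[of p] by simp
next
  case False
  with assms have "degree p < degree (monom (1::real) n)" by (simp add: degree_monom_eq)
  from poly_divide_tendsto_0_at_infinity[OF this] show ?thesis
    using False assms by (simp add: poly_monom coeff_eq_0)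
qed

text \<open>Writing \<open>y\<close> for the root, factor \<open>y ^ Suc n - x ^ Suc n\<close> as
  \<open>y - x\<close> times a sum of \<open>Suc n\<close> monomials. Divided by
  \<open>x ^ n\<close>, the sum tends to \<open>Suc n\<close> because \<open>y / x\<close> tends to
  1, and the left side tends to \<open>coeff g n / lead_coeff g\<close>.\<close>

lemma root_poly_minus_id_tendsto:
  fixes g :: "real poly"
  assumes d: "degree g = Suc n" and a: "lead_coeff g > 0"
  shows "((\<lambda>x. root (Suc n) (poly g x / lead_coeff g) - x) \<longlongrightarrow>
           coeff g n / lead_coeff g / real (Suc n)) at_top"
proof -
  define a where "a = lead_coeff g"
  \<comment> \<open>\<open>h\<close> is the normalised \<open>g\<close> without its leading term;
    its value is \<open>y ^ Suc n - x ^ Suc n\<close> wherever \<open>g\<close> is positive.\<close>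
  define h where "h = smult (1 / a) g - monom 1 (Suc n)"
  define y where "y = (\<lambda>x. root (Suc n) (poly g x / a))"
  have "a > 0" using assms by (simp add: a_def)
  have "degree h \<le> n"
  proof (rule degree_le, intro allI impI)
    fix i assume "n < i"
    then consider "i = Suc n" | "i > Suc n" by linarith
    then show "coeff h i = 0"
      using \<open>a > 0\<close> d by cases (auto simp: h_def a_def coeff_eq_0)
  qed
  have poly_h: "poly h x = poly g x / a - x ^ Suc n" for x
    by (simp add: h_def poly_monom field_simps)
  have h_lim: "((\<lambda>x. poly h x / x ^ n) \<longlongrightarrow> coeff g n / a) at_top"
    using poly_divide_power_tendsto[OF \<open>degree h \<le> n\<close>] at_top_le_at_infinity
    by (auto simp: h_def intro: tendsto_mono)
  have g_lim: "((\<lambda>x. poly g x / x ^ Suc n) \<longlongrightarrow> a) at_top"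
    using poly_divide_power_tendsto[of g "Suc n"] d at_top_le_at_infinity
    by (auto simp: a_def intro: tendsto_mono)
  have ev: "eventually (\<lambda>x. x > 0 \<and> poly g x > 0) at_top"
    using eventually_gt_at_top[of 0] order_tendstoD(1)[OF g_lim \<open>a > 0\<close>]
    by eventually_elim (use zero_less_power in \<open>fastforce simp: zero_less_divide_iff simp del: power_Suc\<close>)
  have "((\<lambda>x. root (Suc n) (poly g x / x ^ Suc n / a)) \<longlongrightarrow> root (Suc n) (a / a)) at_top"
    using \<open>a > 0\<close> by (intro tendsto_intros g_lim) auto
  moreover have "eventually (\<lambda>x. root (Suc n) (poly g x / x ^ Suc n / a) = y x / x) at_top"
    using ev
  proof eventually_elim
    case (elim x)
    have "root (Suc n) (poly g x / x ^ Suc n / a) = root (Suc n) (poly g x / a / x ^ Suc n)"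
      by (simp add: field_simps)
    also have "\<dots> = y x / root (Suc n) (x ^ Suc n)" by (simp only: y_def real_root_divide)
    also have "root (Suc n) (x ^ Suc n) = x" using elim by (intro real_root_power_cancel) auto
    finally show ?case .
  qed
  ultimately have "((\<lambda>x. y x / x) \<longlongrightarrow> root (Suc n) (a / a)) at_top"
    by (rule Lim_transform_eventually)
  then have y_lim: "((\<lambda>x. y x / x) \<longlongrightarrow> 1) at_top"
    using \<open>a > 0\<close> by simp
  define s where "s = (\<lambda>x. \<Sum>i<Suc n. (y x / x) ^ i)"
  have "(s \<longlongrightarrow> (\<Sum>i<Suc n. 1 ^ i)) at_top"
    unfolding s_def by (intro tendsto_intros y_lim)
  then have s_lim: "(s \<longlongrightarrow> real (Suc n)) at_top" by simp
  have "((\<lambda>x. poly h x / x ^ n / s x) \<longlongrightarrow> coeff g n / a / real (Suc n)) at_top"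
    by (intro tendsto_divide h_lim s_lim) simp
  moreover have "eventually (\<lambda>x. poly h x / x ^ n / s x = y x - x) at_top"
    using ev
  proof eventually_elim
    case (elim x)
    have pow: "y x ^ Suc n = poly g x / a"
      unfolding y_def using elim \<open>a > 0\<close> by (intro real_root_pow_pos2) auto
    have "y x > 0" unfolding y_def using elim \<open>a > 0\<close> by (intro real_root_gt_zero) auto
    have "(\<Sum>i<Suc n. y x ^ i * x ^ (n - i)) = x ^ n * s x"
      unfolding s_def sum_distrib_left using elim
      by (intro sum.cong) (auto simp: power_divide power_diff)
    then have "poly h x = (y x - x) * (x ^ n * s x)"
      unfolding poly_h pow[symmetric] diff_power_eq_sum by simp
    moreover have "s x > 0"
      unfolding s_def using elim \<open>y x > 0\<close> by (intro sum_pos) auto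
    ultimately show ?case using elim by (simp add: field_simps)
  qed
  ultimately show ?thesis unfolding a_def y_def by (rule Lim_transform_eventually)
qed

text \<open>For a positive leading coefficient this is the limit just proved. For a negative one
  \<open>poly f m > 0\<close> fails for all large \<open>m\<close>, so any \<open>e\<close>
  works.\<close>

lemma root_poly_approx_pos:
  fixes f :: "int poly"
  assumes d: "degree f > 0"
  shows "\<exists>e. \<forall>\<epsilon>>0. \<exists>M. \<forall>m\<ge>M. poly f m > 0 \<longrightarrow>
           \<bar>root (degree f) (of_int (poly f m) / of_int \<bar>lead_coeff f\<bar>) - of_int m - e\<bar> < \<epsilon>"
proof -
  have "f \<noteq> 0" using d by auto
  then consider "lead_coeff f > 0" | "lead_coeff f < 0"
    using leading_coeff_neq_0 linorder_neqE by blast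
  then show ?thesis
  proof cases
    case 1
    obtain n where n: "degree f = Suc n" using d gr0_conv_Suc by auto
    define e where "e = coeff (real_poly f) n / lead_coeff (real_poly f) / real (Suc n)"
    have lim: "((\<lambda>x. root (Suc n) (poly (real_poly f) x / lead_coeff (real_poly f)) - x) \<longlongrightarrow> e) at_top"
      unfolding e_def using n 1
      by (intro root_poly_minus_id_tendsto) (auto simp: degree_real_poly coeff_real_poly)
    show ?thesis
    proof (intro exI[of _ e] allI impI)
      fix \<epsilon> :: real assume "\<epsilon> > 0"
      from tendstoD[OF lim this] obtain X where
        X: "\<And>x. x \<ge> X \<Longrightarrow> dist (root (Suc n) (poly (real_poly f) x / lead_coeff (real_poly f)) - x) e < \<epsilon>"
        by (auto simp: eventually_at_top_linorder)
      show "\<exists>M. \<forall>m\<ge>M. poly f m > 0 \<longrightarrow>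
           \<bar>root (degree f) (of_int (poly f m) / of_int \<bar>lead_coeff f\<bar>) - of_int m - e\<bar> < \<epsilon>"
      proof (intro exI[of _ "\<lceil>X\<rceil>"] allI impI)
        fix m assume "m \<ge> \<lceil>X\<rceil>"
        then have "real_of_int m \<ge> X" by linarith
        from X[OF this] show "\<bar>root (degree f) (of_int (poly f m) / of_int \<bar>lead_coeff f\<bar>) - of_int m - e\<bar> < \<epsilon>"
          unfolding poly_real_poly using 1 n by (simp add: degree_real_poly coeff_real_poly dist_real_def)
      qed
    qed
  next
    case 2
    obtain N where "\<And>n. n \<ge> N \<Longrightarrow> poly (- f) n > 0"
      using int_poly_gt[of "- f" 0] 2 d by auto
    then have "\<not> poly f m > 0" if "m \<ge> N" for m using that by force
    then show ?thesis by blast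
  qed
qed

text \<open>Reflection carries facts about large positive arguments over to large negative ones. The
  sign of the leading coefficient changes with the parity of the degree, so only its modulus is
  recorded.\<close>

lemma poly_reflect:
  fixes f :: "int poly"
  defines "g \<equiv> pcompose f [:0, -1:]"
  shows "poly g x = poly f (- x)" "degree g = degree f" "\<bar>lead_coeff g\<bar> = \<bar>lead_coeff f\<bar>"
proof -
  have "lead_coeff g = lead_coeff f * (-1) ^ degree f"
    unfolding g_def by (subst lead_coeff_comp) auto
  then show "\<bar>lead_coeff g\<bar> = \<bar>lead_coeff f\<bar>" by (simp add: abs_mult power_abs)
qed (simp_all add: g_def poly_pcompose degree_pcompose)

text \<open>The two half-lines are handled by \<open>f\<close> and its reflection. Their constants
  may differ, so \<open>e\<close> is indexed by the truth value of \<open>m \<ge> 0\<close>.\<close>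

lemma root_poly_approx:
  fixes f :: "int poly"
  assumes d: "degree f > 0"
  obtains e :: "bool \<Rightarrow> real" where
    "\<And>\<epsilon>. \<epsilon> > 0 \<Longrightarrow> \<exists>M. \<forall>m. \<bar>m\<bar> \<ge> M \<and> poly f m > 0 \<longrightarrow>
       \<bar>root (degree f) (of_int (poly f m) / of_int \<bar>lead_coeff f\<bar>) - of_int \<bar>m\<bar> - e (m \<ge> 0)\<bar> < \<epsilon>"
proof -
  let ?P = "\<lambda>m e \<epsilon>. \<bar>root (degree f) (of_int (poly f m) / of_int \<bar>lead_coeff f\<bar>) - of_int \<bar>m\<bar> - e\<bar> < \<epsilon>"
  let ?g = "pcompose f [:0, -1:]"
  from root_poly_approx_pos[OF d] obtain e1 where e1:
    "\<And>\<epsilon>. \<epsilon> > 0 \<Longrightarrow> \<exists>M. \<forall>m\<ge>M. poly f m > 0 \<longrightarrow>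
       \<bar>root (degree f) (of_int (poly f m) / of_int \<bar>lead_coeff f\<bar>) - of_int m - e1\<bar> < \<epsilon>"
    by blast
  have "degree ?g > 0" using d poly_reflect(2) by metis
  from root_poly_approx_pos[OF this] obtain e2 where e2:
    "\<And>\<epsilon>. \<epsilon> > 0 \<Longrightarrow> \<exists>M. \<forall>m\<ge>M. poly f (- m) > 0 \<longrightarrow>
       \<bar>root (degree f) (of_int (poly f (- m)) / of_int \<bar>lead_coeff f\<bar>) - of_int m - e2\<bar> < \<epsilon>"
    unfolding poly_reflect(3) unfolding poly_reflect(1,2) by blast
  show thesis
  proof (rule that[of "\<lambda>b. if b then e1 else e2"])
    fix \<epsilon> :: real assume "\<epsilon> > 0"
    from e1[OF this] obtain M1 where M1:
      "\<And>m. m \<ge> M1 \<Longrightarrow> poly f m > 0 \<Longrightarrow>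
       \<bar>root (degree f) (of_int (poly f m) / of_int \<bar>lead_coeff f\<bar>) - of_int m - e1\<bar> < \<epsilon>" by blast
    from e2[OF \<open>\<epsilon> > 0\<close>] obtain M2 where M2:
      "\<And>m. m \<ge> M2 \<Longrightarrow> poly f (- m) > 0 \<Longrightarrow>
       \<bar>root (degree f) (of_int (poly f (- m)) / of_int \<bar>lead_coeff f\<bar>) - of_int m - e2\<bar> < \<epsilon>" by blast
    show "\<exists>M. \<forall>m. \<bar>m\<bar> \<ge> M \<and> poly f m > 0 \<longrightarrow> ?P m (if m \<ge> 0 then e1 else e2) \<epsilon>"
    proof (intro exI[of _ "max M1 M2"] allI impI)
      fix m assume m: "\<bar>m\<bar> \<ge> max M1 M2 \<and> poly f m > 0"
      show "?P m (if m \<ge> 0 then e1 else e2) \<epsilon>"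
      proof (cases "m \<ge> 0")
        case True
        then show ?thesis using M1[of m] m by simp
      next
        case False
        then show ?thesis using M2[of "- m"] m by simp
      qed
    qed
  qed
qed

section \<open>Integrality, valuations and the degree of \<open>f\<close>\<close>

lemma Ints_if_approx:
  fixes \<beta> :: real
  assumes "\<And>\<epsilon>. \<epsilon> > 0 \<Longrightarrow> \<exists>N::int. \<bar>of_int N - \<beta>\<bar> < \<epsilon>"
  obtains z :: int where "\<beta> = of_int z"
proof -
  obtain N :: int where N: "\<bar>of_int N - \<beta>\<bar> < 1/2" using assms[of "1/2"] by auto
  have "\<beta> = of_int N"
  proof (rule ccontr)
    assume ne: "\<beta> \<noteq> of_int N"
    \<comment> \<open>An integer strictly closer to \<open>\<beta>\<close> than \<open>N\<close> is
      within distance 1 of \<open>N\<close>, hence equal to \<open>N\<close>.\<close>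
    then obtain N' :: int where N': "\<bar>of_int N' - \<beta>\<bar> < \<bar>of_int N - \<beta>\<bar>"
      using assms[of "\<bar>of_int N - \<beta>\<bar>"] by auto
    then have "\<bar>real_of_int N' - of_int N\<bar> < 1" using N by linarith
    then have "N' = N" by linarith
    with N' show False by simp
  qed
  then show thesis using that by blast
qed

text \<open>Raising to the power \<open>d\<close> gives \<open>w ^ d * p = (4 * p) ^ d\<close> with
  \<open>w = z\<close>. As \<open>p\<close> is odd, \<open>4 * p\<close> has \<open>p\<close>-adic
  valuation 1, so \<open>d * multiplicity p w + 1 = d\<close> and \<open>d\<close> divides
  1.\<close>

lemma degree_1_if_prime_root:
  fixes p d :: nat and z :: int
  assumes "prime p" "odd p" "d > 0" and z: "of_int z * root d (real p) = 4 * real p"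
  shows "d = 1"
proof -
  have "p > 0" using assms(1) prime_gt_0_nat by blast
  have "real_of_int z > 0"
    using z \<open>p > 0\<close> \<open>d > 0\<close> by (metis mult_pos_pos of_nat_0_less_iff real_root_gt_zero zero_less_mult_pos2 zero_less_numeral)
  then have "z > 0" by simp
  then obtain w where w: "z = int w" "w > 0" by (metis zero_less_imp_eq_int)
  have "(of_int z * root d (real p)) ^ d = (4 * real p) ^ d" using z by simp
  then have "real (w ^ d * p) = real ((4 * p) ^ d)"
    using w \<open>d > 0\<close> by (simp add: power_mult_distrib real_root_pow_pos2)
  then have eq: "w ^ d * p = (4 * p) ^ d" by (simp only: of_nat_eq_iff)
  have "\<not> p dvd 4"
  proof
    assume "p dvd 4"
    then have "p dvd 2 * 2" by simp
    then have "p dvd 2" using assms(1) prime_dvd_mult_iff by blast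
    then show False using primes_dvd_imp_eq[OF assms(1) two_is_prime_nat] assms(2) by simp
  qed
  then have "multiplicity p (4 * p) = 1"
    using assms(1) \<open>p > 0\<close>
    by (simp add: prime_elem_multiplicity_mult_distrib not_dvd_imp_multiplicity_0)
  moreover have "multiplicity p (w ^ d * p) = d * multiplicity p w + 1"
    using assms(1) \<open>p > 0\<close> w(2)
    by (simp add: prime_elem_multiplicity_mult_distrib prime_elem_multiplicity_power_distrib)
  moreover have "multiplicity p ((4 * p) ^ d) = d * multiplicity p (4 * p)"
    using assms(1) \<open>p > 0\<close> by (intro prime_elem_multiplicity_power_distrib) auto
  ultimately have "d * multiplicity p w + 1 = d" using eq by simp
  then have "d dvd 1" by (metis dvd_add_right_iff dvd_refl dvd_triv_left)
  then show ?thesis by simp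
qed


text \<open>\<open>val\<close> allows any integer argument, whereas \<open>mem\<close> is asked only
  from \<open>n0\<close> on; in this form the hypotheses fit both shapes of the value set.\<close>

lemma degree_1_if_odd_dvd_closed:
  fixes f :: "int poly" and B :: "nat set"
  assumes lc: "lead_coeff f > 0" and d: "degree f > 0"
    and n0: "poly f n0 = 1"
    and val: "\<And>b. b \<in> B \<Longrightarrow> \<exists>m. poly f m = int b"
    and mem: "\<And>n. n \<ge> n0 \<Longrightarrow> poly f n > 0 \<Longrightarrow> nat (poly f n) \<in> B"
    and dvd: "\<And>b c. b \<in> B \<Longrightarrow> odd b \<Longrightarrow> c dvd b \<Longrightarrow> c \<in> B"
  shows "degree f = 1"
proof -
  obtain N1 where N1: "\<And>n. n \<ge> N1 \<Longrightarrow> poly f n > 1" using int_poly_gt[OF lc d] by blast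
  \<comment> \<open>An even shift of \<open>n0\<close> past \<open>N1\<close>: \<open>f\<close>
    keeps its parity there, so \<open>poly f n1\<close> is odd like \<open>poly f n0 = 1\<close>,
    and it exceeds 1.\<close>
  define n1 where "n1 = n0 + 2 * (\<bar>N1\<bar> + \<bar>n0\<bar>)"
  have n1: "n1 \<ge> n0" "n1 \<ge> N1" by (auto simp: n1_def)
  have "n1 - n0 dvd poly f n1 - poly f n0" by (rule poly_diff_dvd)
  moreover have "2 dvd n1 - n0" by (simp add: n1_def)
  ultimately have "2 dvd poly f n1 - 1" using n0 by (metis dvd_trans)
  then have odd_n1: "odd (nat (poly f n1))" using N1[OF n1(2)] by (simp add: even_nat_iff)
  have "nat (poly f n1) \<noteq> 1" using N1[OF n1(2)] by auto
  then obtain p where p: "prime p" "p dvd nat (poly f n1)" using prime_factor_nat by blast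
  have "nat (poly f n1) \<in> B" using N1[OF n1(2)] by (intro mem n1) auto
  then have "p \<in> B" using odd_n1 p(2) dvd by blast
  have "odd p" using odd_n1 p(2) by (metis dvd_trans)
  have "p > 0" using p(1) prime_gt_0_nat by blast
  obtain m where m: "poly f m = int p" using val[OF \<open>p \<in> B\<close>] by blast

  \<comment> \<open>Shifts by multiples of \<open>2 * p\<close> preserve \<open>f\<close> modulo
    \<open>2 * p\<close>, so \<open>poly f (x k)\<close> is \<open>p\<close> times an odd
    number.\<close>
  define x where "x = (\<lambda>k. m + 2 * int p * k)"
  have x_ge: "x k \<ge> N" if "k \<ge> \<bar>N\<bar> + \<bar>m\<bar>" for k N
  proof -
    have "1 * k \<le> (2 * int p) * k" using \<open>p > 0\<close> that by (intro mult_right_mono) auto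
    then show ?thesis using that by (simp add: x_def)
  qed
  define N2 where "N2 = max N1 n0"
  define k0 where "k0 = \<bar>N2\<bar> + \<bar>m\<bar>"
  have "\<exists>y. poly f (x k) = int p * poly f y \<and> poly f y > 0" if "k \<ge> k0" for k
  proof -
    have xk: "x k \<ge> N1" "x k \<ge> n0" using x_ge[of N2 k] that by (auto simp: k0_def N2_def)
    have "x k - m dvd poly f (x k) - poly f m" by (rule poly_diff_dvd)
    then have *: "int p * 2 dvd poly f (x k) - int p"
      unfolding m by (rule dvd_trans[rotated]) (simp add: x_def)
    then obtain j where "poly f (x k) - int p = int p * 2 * j" by (elim dvdE)
    then have fx: "poly f (x k) = int p * (1 + 2 * j)" by (simp add: algebra_simps)
    define w where "w = nat (1 + 2 * j)"
    have pos: "poly f (x k) > 0" using N1[OF xk(1)] by simp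
    then have "1 + 2 * j > 0" using fx \<open>p > 0\<close> by (simp add: zero_less_mult_iff)
    then have w: "int w = 1 + 2 * j" by (simp add: w_def)
    then have "odd (int w)" by simp
    then have "odd w" by simp
    have nat_fx: "nat (poly f (x k)) = p * w" unfolding fx w[symmetric] by (simp add: nat_mult_distrib)
    have "p * w \<in> B" using mem[OF xk(2) pos] nat_fx by simp
    then have "w \<in> B" using dvd[of "p * w" w] \<open>odd p\<close> \<open>odd w\<close> by simp
    then obtain y where "poly f y = int w" using val by blast
    then show ?thesis using fx w \<open>1 + 2 * j > 0\<close> by (intro exI[of _ y]) auto
  qed
  then obtain y where y: "\<And>k. k \<ge> k0 \<Longrightarrow> poly f (x k) = int p * poly f (y k)"
    and y_pos: "\<And>k. k \<ge> k0 \<Longrightarrow> poly f (y k) > 0" by metis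
  have y_large: "\<exists>K. \<forall>k\<ge>K. \<bar>y k\<bar> \<ge> M" for M
  proof -
    \<comment> \<open>\<open>C\<close> bounds \<open>f\<close> on the interval, so once
      \<open>poly f (x k) / p\<close> exceeds \<open>C\<close>, \<open>y k\<close> must lie
      outside.\<close>
    define C where "C = Max (insert 0 (poly f ` {-\<bar>M\<bar>..\<bar>M\<bar>}))"
    obtain N where N: "\<And>n. n \<ge> N \<Longrightarrow> poly f n > int p * C" using int_poly_gt[OF lc d] by blast
    show ?thesis
    proof (intro exI[of _ "max k0 (\<bar>N\<bar> + \<bar>m\<bar>)"] allI impI)
      fix k assume k: "k \<ge> max k0 (\<bar>N\<bar> + \<bar>m\<bar>)"
      have "poly f (x k) > int p * C" using N x_ge k by simp
      then have "poly f (y k) > C" using y[of k] k \<open>p > 0\<close> by simp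
      then have "poly f (y k) \<notin> poly f ` {-\<bar>M\<bar>..\<bar>M\<bar>}"
        unfolding C_def by (metis Max_ge finite_imageI finite_atLeastAtMost_int finite_insert insertI2 not_less)
      then have "y k \<notin> {-\<bar>M\<bar>..\<bar>M\<bar>}" by blast
      then show "\<bar>y k\<bar> \<ge> M" by simp linarith
    qed
  qed

  define \<rho> where "\<rho> = root (degree f) (real p)"
  have "\<rho> \<ge> 1" unfolding \<rho>_def using \<open>p > 0\<close> d by simp
  define R where "R = (\<lambda>n. root (degree f) (of_int (poly f n) / of_int \<bar>lead_coeff f\<bar>))"
  have R: "R (x k) = \<rho> * R (y k)" if "k \<ge> k0" for k
    unfolding R_def \<rho>_def y[OF that] real_root_mult[symmetric] by simp
  obtain e where e: "\<And>\<epsilon>. \<epsilon> > 0 \<Longrightarrow> \<exists>M. \<forall>n. \<bar>n\<bar> \<ge> M \<and> poly f n > 0 \<longrightarrow>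
      \<bar>R n - of_int \<bar>n\<bar> - e (n \<ge> 0)\<bar> < \<epsilon>"
    using root_poly_approx[OF d] unfolding R_def by blast
  have "\<exists>N::int. \<bar>of_int N - 4 * real p / \<rho>\<bar> < \<epsilon>" if "\<epsilon> > 0" for \<epsilon>
  proof -
    \<comment> \<open>Comparing two indices costs \<open>4 * \<delta>\<close>, and a doubling below
      makes it \<open>8 * \<delta>\<close>, still below \<open>\<epsilon>\<close>.\<close>
    define \<delta> where "\<delta> = \<epsilon> / 10"
    have "\<delta> > 0" using that by (simp add: \<delta>_def)
    from e[OF this] obtain M where
      M: "\<And>n. \<bar>n\<bar> \<ge> M \<Longrightarrow> poly f n > 0 \<Longrightarrow> \<bar>R n - of_int \<bar>n\<bar> - e (n \<ge> 0)\<bar> < \<delta>" by blast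
    obtain K where K: "\<And>k. k \<ge> K \<Longrightarrow> \<bar>y k\<bar> \<ge> M" using y_large by blast
    define k1 where "k1 = Max {K, k0, \<bar>M\<bar> + \<bar>m\<bar>, \<bar>0\<bar> + \<bar>m\<bar>}"
    have k1: "k1 \<ge> K" "k1 \<ge> k0" "k1 \<ge> \<bar>M\<bar> + \<bar>m\<bar>" "k1 \<ge> \<bar>0\<bar> + \<bar>m\<bar>" by (auto simp: k1_def)
    \<comment> \<open>Divide the approximation at \<open>x k\<close> by
      \<open>\<rho> \<ge> 1\<close>, which does not enlarge its error, and combine it with the one
      at \<open>y k\<close> through \<open>R (x k) = \<rho> * R (y k)\<close>.\<close>
    have approx: "\<bar>of_int \<bar>y k\<bar> - (of_int (x k) + e True) / \<rho> + e (y k \<ge> 0)\<bar> < 2 * \<delta>"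
      if k: "k \<ge> k1" for k
    proof -
      have "x k \<ge> 0" "x k \<ge> M" using x_ge[of 0 k] x_ge[of M k] k k1 by linarith+
      moreover have "poly f (x k) > 0" using y[of k] y_pos[of k] k k1 \<open>p > 0\<close> by simp
      ultimately have 1: "\<bar>R (x k) - of_int (x k) - e True\<bar> < \<delta>" using M[of "x k"] by simp
      have "\<bar>(R (x k) - of_int (x k) - e True) / \<rho>\<bar> = \<bar>R (x k) - of_int (x k) - e True\<bar> / \<rho>"
        using \<open>\<rho> \<ge> 1\<close> by (simp add: abs_divide)
      also have "\<dots> \<le> \<bar>R (x k) - of_int (x k) - e True\<bar> / 1"
        using \<open>\<rho> \<ge> 1\<close> by (intro divide_left_mono) auto
      also have "\<dots> < \<delta>" using 1 by simp
      also have "(R (x k) - of_int (x k) - e True) / \<rho> = R (y k) - (of_int (x k) + e True) / \<rho>"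
        using R[of k] k k1 \<open>\<rho> \<ge> 1\<close> by (simp add: field_simps)
      finally have 2: "\<bar>R (y k) - (of_int (x k) + e True) / \<rho>\<bar> < \<delta>" .
      have "\<bar>R (y k) - of_int \<bar>y k\<bar> - e (y k \<ge> 0)\<bar> < \<delta>"
        using k k1 by (intro M K y_pos) auto
      with 2 show ?thesis by linarith
    qed
    have abs_diff: "\<bar>B - A - (Y - X)\<bar> < 4 * \<delta>"
      if "\<bar>A - X + E\<bar> < 2 * \<delta>" "\<bar>B - Y + E\<bar> < 2 * \<delta>" for A B X Y E
      using that by linarith
    \<comment> \<open>Equal signs of \<open>y i\<close> and \<open>y j\<close> mean equal constants
      \<open>e\<close>, which cancel in the difference.\<close>
    have diff: "\<bar>of_int (\<bar>y j\<bar> - \<bar>y i\<bar>) - 2 * real p * of_int (j - i) / \<rho>\<bar> < 4 * \<delta>"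
      if "i \<ge> k1" "j \<ge> k1" "y i \<ge> 0 \<longleftrightarrow> y j \<ge> 0" for i j
    proof -
      have "2 * real p * of_int (j - i) / \<rho> = (of_int (x j) + e True) / \<rho> - (of_int (x i) + e True) / \<rho>"
        unfolding x_def by (simp add: diff_divide_distrib[symmetric] algebra_simps)
      then show ?thesis
        using abs_diff[OF approx[OF that(1), unfolded that(3)] approx[OF that(2)]]
        by (simp only: of_int_diff)
    qed
    \<comment> \<open>Among three indices two share a sign; their distance is 1 or 2, giving
      \<open>2 * p / \<rho>\<close> or \<open>4 * p / \<rho>\<close>.\<close>
    consider "y k1 \<ge> 0 \<longleftrightarrow> y (k1 + 1) \<ge> 0" | "y (k1 + 1) \<ge> 0 \<longleftrightarrow> y (k1 + 2) \<ge> 0"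
      | "y k1 \<ge> 0 \<longleftrightarrow> y (k1 + 2) \<ge> 0" by blast
    then have "\<exists>N::int. \<bar>of_int N - 2 * real p / \<rho>\<bar> < 4 * \<delta> \<or> \<bar>of_int N - 4 * real p / \<rho>\<bar> < 4 * \<delta>"
      using diff[of k1 "k1 + 1"] diff[of "k1 + 1" "k1 + 2"] diff[of k1 "k1 + 2"]
      by cases (auto simp del: of_int_diff)
    then obtain N :: int where
      "\<bar>of_int N - 2 * real p / \<rho>\<bar> < 4 * \<delta> \<or> \<bar>of_int N - 4 * real p / \<rho>\<bar> < 4 * \<delta>" by blast
    then show ?thesis
    proof
      assume *: "\<bar>of_int N - 2 * real p / \<rho>\<bar> < 4 * \<delta>"
      \<comment> \<open>Doubling brings the case of distance 1 to the common limit
        \<open>4 * p / \<rho>\<close>.\<close>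
      have "of_int (2 * N) - 4 * real p / \<rho> = 2 * (of_int N - 2 * real p / \<rho>)" by simp
      then have "\<bar>of_int (2 * N) - 4 * real p / \<rho>\<bar> = 2 * \<bar>of_int N - 2 * real p / \<rho>\<bar>"
        by (simp only: abs_mult abs_numeral)
      with * have "\<bar>of_int (2 * N) - 4 * real p / \<rho>\<bar> < \<epsilon>"
        unfolding \<delta>_def using that by linarith
      then show ?thesis by blast
    next
      assume "\<bar>of_int N - 4 * real p / \<rho>\<bar> < 4 * \<delta>"
      then have "\<bar>of_int N - 4 * real p / \<rho>\<bar> < \<epsilon>" unfolding \<delta>_def using that by linarith
      then show ?thesis by blast
    qed
  qed
  then obtain z :: int where "4 * real p / \<rho> = of_int z" using Ints_if_approx by blast
  then have "of_int z * root (degree f) (real p) = 4 * real p"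
    using \<open>\<rho> \<ge> 1\<close> unfolding \<rho>_def by (simp add: field_simps)
  then show ?thesis using degree_1_if_prime_root p(1) \<open>odd p\<close> d by blast
qed

section \<open>The linear case and the sign of the leading coefficient\<close>

lemma poly_degree_1:
  fixes f :: "int poly"
  assumes "degree f = 1"
  shows "poly f x = poly f y + lead_coeff f * (x - y)"
  using assms by (auto simp: poly_altdef algebra_simps)

lemma linear_if_odd_dvd_closed:
  fixes f :: "int poly" and B :: "nat set"
  assumes lc: "lead_coeff f > 0" and d: "degree f > 0"
    and n0: "poly f n0 = 1"
    and val: "\<And>b. b \<in> B \<Longrightarrow> b > 0 \<and> (\<exists>m. poly f m = int b)"
    and mem: "\<And>n. n \<ge> n0 \<Longrightarrow> poly f n > 0 \<Longrightarrow> nat (poly f n) \<in> B"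
    and dvd: "\<And>b c. b \<in> B \<Longrightarrow> odd b \<Longrightarrow> c dvd b \<Longrightarrow> c \<in> B"
  shows "B = posnat \<or> B = {2 * n - 1 | n. n \<in> posnat}"
proof -
  define a where "a = lead_coeff f"
  have "a > 0" using lc by (simp add: a_def)
  have deg: "degree f = 1" using val by (intro degree_1_if_odd_dvd_closed[OF lc d n0 _ mem dvd]) auto
  have B: "b \<in> B \<longleftrightarrow> b > 0 \<and> a dvd int b - 1" for b
  proof
    assume "b \<in> B"
    then obtain m where "b > 0" "poly f m = int b" using val by blast
    then have "int b - 1 = a * (m - n0)" using poly_degree_1[OF deg, of m n0] n0 by (simp add: a_def)
    then show "b > 0 \<and> a dvd int b - 1" using \<open>b > 0\<close> by simp
  next
    assume b: "b > 0 \<and> a dvd int b - 1"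
    then obtain t where t: "int b - 1 = a * t" by blast
    \<comment> \<open>\<open>b \<ge> 1\<close> forces \<open>t \<ge> 0\<close>, so
      \<open>n0 + t\<close> lies in the range where \<open>mem\<close> applies.\<close>
    moreover have "a * t \<ge> 0" using b t by linarith
    ultimately have "t \<ge> 0" using \<open>a > 0\<close> by (simp add: zero_le_mult_iff)
    have "poly f (n0 + t) = int b"
      using poly_degree_1[OF deg, of "n0 + t" n0] n0 t by (simp add: a_def)
    then show "b \<in> B" using mem[of "n0 + t"] \<open>t \<ge> 0\<close> b by simp
  qed
  \<comment> \<open>\<open>c\<close> is odd and congruent to -1 modulo \<open>a\<close>, so
    \<open>c * c\<close> is odd and congruent to 1 for every \<open>a\<close>. Membership of
    \<open>c\<close> itself then makes -1 and 1 congruent modulo \<open>a\<close>.\<close>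
  define c where "c = nat (2 * a - 1)"
  have c: "int c = 2 * a - 1" "odd c" "c > 0" using \<open>a > 0\<close> by (auto simp: c_def even_nat_iff)
  have "int (c * c) - 1 = a * (4 * a - 4)" by (simp add: c(1) algebra_simps)
  then have "c * c \<in> B" using c by (simp add: B)
  then have "c \<in> B" using dvd[of "c * c" c] c by simp
  then have "a dvd 2 * a - 2" using c by (simp add: B)
  then have "a dvd 2" using dvd_diff_right_iff[of a "2 * a" 2] by simp
  then have "a = 1 \<or> a = 2" using \<open>a > 0\<close> zdvd_imp_le[of a 2] by auto
  then show ?thesis
  proof
    assume "a = 1"
    then have "b \<in> B \<longleftrightarrow> b \<in> posnat" for b using B[of b] by (auto simp: posnat_def)
    then show ?thesis by blast
  next
    assume "a = 2"
    then have "b \<in> B \<longleftrightarrow> odd b" for b using B[of b] by (cases "b = 0") auto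
    then show ?thesis unfolding odd_numbers_eq by blast
  qed
qed

text \<open>A nonconstant \<open>f\<close> then tends to minus infinity in both directions, so its
  positive values come from a bounded interval. Contrapositively, an infinite \<open>B\<close> gives
  \<open>f\<close> or its reflection a positive leading coefficient.\<close>

lemma finite_pos_values:
  fixes f :: "int poly"
  assumes "lead_coeff f \<le> 0" "lead_coeff (pcompose f [:0, -1:]) \<le> 0"
  shows "finite {b. \<exists>n. int b = poly f n \<and> b > 0}"
proof (cases "degree f = 0")
  case True
  then have "{b. \<exists>n. int b = poly f n \<and> b > 0} \<subseteq> {nat (coeff f 0)}" by (auto simp: poly_altdef)
  then show ?thesis using finite_subset by blast
next
  case False
  have bound: "\<exists>N. \<forall>n\<ge>N. poly g n < 0" if "lead_coeff g \<le> 0" "degree g > 0" for g :: "int poly"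
  proof -
    have "lead_coeff g \<noteq> 0" using that by auto
    then have "lead_coeff g < 0" using that by linarith
    then have "lead_coeff (- g) > 0" by simp
    then show ?thesis using int_poly_gt[of "- g" 0] that by auto
  qed
  obtain N1 where N1: "\<And>n. n \<ge> N1 \<Longrightarrow> poly f n < 0" using bound assms(1) False by blast
  have "degree (pcompose f [:0, -1:]) > 0" using False poly_reflect(2)[of f] by simp
  then obtain N2 where N2: "\<And>n. n \<ge> N2 \<Longrightarrow> poly f (- n) < 0"
    using bound[OF assms(2)] unfolding poly_reflect(1) by blast
  have "{b. \<exists>n. int b = poly f n \<and> b > 0} \<subseteq> (\<lambda>n. nat (poly f n)) ` {- N2..N1}"
  proof
    fix b assume "b \<in> {b. \<exists>n. int b = poly f n \<and> b > 0}"
    then obtain n where n: "int b = poly f n" "b > 0" by blast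
    then have "n \<le> N1" "- n \<le> N2" using N1[of n] N2[of "- n"] by force+
    then show "b \<in> (\<lambda>n. nat (poly f n)) ` {- N2..N1}" using n
      by (intro image_eqI[of _ _ n]) auto
  qed
  then show ?thesis using finite_subset by blast
qed

section \<open>The equivalence for both forms of \<open>B\<close>\<close>

theorem theorem4p8:
  fixes f :: "int poly" and B :: "nat set"
  assumes "B = {b \<in> posnat. int b \<in> range (poly f)} \<or>
           B = {b \<in> posnat. int b \<in> (\<lambda>n. poly f (int n)) ` posnat}"
    and "infinite B"
  shows "(\<exists>A. A \<subseteq> posnat \<and> B = Pr A) \<longleftrightarrow> B = posnat \<or> B = {2 * n - 1 | n. n \<in> posnat}"
proof
  assume "B = posnat \<or> B = {2 * n - 1 | n. n \<in> posnat}"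
  then show "\<exists>A. A \<subseteq> posnat \<and> B = Pr A"
  proof
    assume "B = posnat"
    then show ?thesis using Pr_empty by blast
  next
    assume "B = {2 * n - 1 | n. n \<in> posnat}"
    moreover have "{2} \<subseteq> posnat" by (simp add: posnat_def)
    ultimately show ?thesis using Pr_2 by blast
  qed
next
  assume "\<exists>A. A \<subseteq> posnat \<and> B = Pr A"
  then obtain A where "B = Pr A" by blast
  have one: "1 \<in> B" unfolding \<open>B = Pr A\<close> by (rule one_in_Pr)
  have dvd: "\<And>b c. b \<in> B \<Longrightarrow> odd b \<Longrightarrow> c dvd b \<Longrightarrow> c \<in> B"
    unfolding \<open>B = Pr A\<close> by (rule odd_in_Pr_dvd)
  \<comment> \<open>A constant \<open>g\<close> would leave at most one element in the infinite set
    \<open>B\<close>.\<close>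
  have deg: "degree g > 0" if "\<And>b. b \<in> B \<Longrightarrow> \<exists>m. poly g m = int b" for g :: "int poly"
  proof (rule ccontr)
    assume "\<not> degree g > 0"
    then have "B \<subseteq> {nat (coeff g 0)}" using that by (force simp: poly_altdef)
    then show False using assms(2) finite_subset by blast
  qed
  have pos: "b > 0" if "b \<in> B" for b
    using that assms(1) by (auto simp: posnat_def)
  from assms(1) show "B = posnat \<or> B = {2 * n - 1 | n. n \<in> posnat}"
  proof
    assume B: "B = {b \<in> posnat. int b \<in> range (poly f)}"
    \<comment> \<open>Over all integers only the range matters, so \<open>f\<close> may be exchanged
      for its reflection to make the leading coefficient positive.\<close>
    have *: ?thesis if lc: "lead_coeff g > 0" and range: "range (poly g) = range (poly f)" for g
    proof -
      have val: "\<exists>m. poly g m = int b" if "b \<in> B" for b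
      proof -
        have "int b \<in> range (poly g)" using that B range by blast
        then show ?thesis by (metis imageE)
      qed
      obtain n0 where n0: "poly g n0 = 1" using val[OF one] by auto
      have mem: "nat (poly g n) \<in> B" if "poly g n > 0" for n
      proof -
        have "int (nat (poly g n)) \<in> range (poly g)" using that by simp
        then have "int (nat (poly g n)) \<in> range (poly f)" unfolding range .
        moreover have "nat (poly g n) \<in> posnat" using that by (simp add: posnat_def)
        ultimately show ?thesis unfolding B by blast
      qed
      show ?thesis
        by (rule linear_if_odd_dvd_closed[OF lc deg[OF val] n0]) (use val pos mem dvd in blast)+
    qed
    have "B \<subseteq> {b. \<exists>n. int b = poly f n \<and> b > 0}" using B pos by blast
    then have "infinite {b. \<exists>n. int b = poly f n \<and> b > 0}" using assms(2) finite_subset by blast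
    then have "lead_coeff f > 0 \<or> lead_coeff (pcompose f [:0, -1:]) > 0"
      using finite_pos_values[of f] by linarith
    moreover have "range (poly (pcompose f [:0, -1:])) = range (poly f)"
    proof -
      have "poly (pcompose f [:0, -1:]) = poly f \<circ> uminus" by (auto simp: poly_reflect(1))
      then show ?thesis by (metis image_comp surj_uminus)
    qed
    ultimately show ?thesis using * by blast
  next
    assume B: "B = {b \<in> posnat. int b \<in> (\<lambda>n. poly f (int n)) ` posnat}"
    have val: "\<exists>m\<ge>1. poly f m = int b" if "b \<in> B" for b
    proof -
      obtain n where "n \<in> posnat" "int b = poly f (int n)" using \<open>b \<in> B\<close> B by blast
      then show ?thesis by (intro exI[of _ "int n"]) (simp add: posnat_def)
    qed
    then have d: "degree f > 0" using deg by blast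
    obtain n0 where n0: "n0 \<ge> 1" "poly f n0 = 1" using val[OF one] by auto
    have mem: "nat (poly f n) \<in> B" if "n \<ge> n0" "poly f n > 0" for n
    proof -
      have "int (nat (poly f n)) = poly f (int (nat n))" "nat n \<in> posnat" "nat (poly f n) \<in> posnat"
        using that n0(1) by (simp_all add: posnat_def)
      then show ?thesis unfolding B by blast
    qed
    \<comment> \<open>Reflection does not preserve the values at positive arguments. Instead, a
      negative leading coefficient would confine the positive values to arguments in
      \<open>{1..N}\<close>, making \<open>B\<close> finite.\<close>
    have lc: "lead_coeff f > 0"
    proof (rule ccontr)
      assume neg: "\<not> lead_coeff f > 0"
      have "lead_coeff f \<noteq> 0" using d by auto
      then have "lead_coeff f < 0" using neg by linarith
      then have "\<exists>N. \<forall>n\<ge>N. poly (- f) n > 0" using d by (intro int_poly_gt) simp_all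
      then obtain N where N: "\<And>n. n \<ge> N \<Longrightarrow> poly f n < 0" by auto
      have "B \<subseteq> (\<lambda>n. nat (poly f n)) ` {1..N}"
      proof
        fix b assume "b \<in> B"
        with val obtain n where n: "n \<ge> 1" "poly f n = int b" by blast
        then have "n \<le> N" using N[of n] by (cases "n \<le> N") simp_all
        then show "b \<in> (\<lambda>n. nat (poly f n)) ` {1..N}" using n
          by (intro image_eqI[of _ _ n]) auto
      qed
      then show False using assms(2) finite_subset by blast
    qed
    show ?thesis
      by (rule linear_if_odd_dvd_closed[OF lc d n0(2)]) (use val pos mem dvd in blast)+
  qed
qed

end
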